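(* The step-size sequence $(\tau_k)$ generated by Algorithm 3 (described in the context) converges to some $\tau^\star\in[\tau_{\min},+\infty)$, where $$\tau_{\min}:=\min\Big\{\tau_0,\frac{\sqrt{\bar\lambda}\,r_1}{\sqrt\beta\,\|A\|}\Big\}>0.$$
   Context: **Problem.** $g:\mathbb{R}^q\to\mathbb{R}\cup\{+\infty\}$ and $f:\mathbb{R}^p\to\mathbb{R}\cup\{+\infty\}$ are proper, closed, convex functions, $A\in\mathbb{R}^{m\times q}$, $B\in\mathbb{R}^{m\times p}$, $b\in\mathbb{R}^m$. The problem is $\min_{x,w} g(x)+f(w)$ subject to $Ax+Bw=b$. Set $\mathbb{L}(x,w,y):=g(x)+f(w)+\langle y,Ax+Bw-b\rangle$ and, for $\sigma>0$, $\mathbb{L}_\sigma(x,w,y):=\mathbb{L}(x,w,y)+\frac{\sigma}{2}\|Ax+Bw-b\|^2$. **Standing assumption.** The solution set of the problem is nonempty, and there exist $\tilde x\in\operatorname{ri}(\operatorname{dom} g)$ and $\tilde w\in\operatorname{ri}(\operatorname{dom} f)$ with $A\tilde x+B\tilde w=b$ ($\operatorname{ri}$ = relative interior). **Notation.** $\|\cdot\|$ is the Euclidean norm on vectors and the operator norm on matrices. For a symmetric positive semidefinite $M$, $\|y\|_M:=\sqrt{y^\top My}$. $\lambda_{\min}(M)$ is the smallest eigenvalue of $M$. $\varphi:=\frac{1+\sqrt5}{2}$. If $A=0$, the quotient with $\|A\|$ in its denominator is read as $+\infty$. **Algorithm 3.** Let $S\in\mathbb{R}^{q\times q}$ and $T\in\mathbb{R}^{p\times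 p}$ be symmetric positive definite, $x_0\in\mathbb{R}^q$, $w_0\in\mathbb{R}^p$, $y_0\in\mathbb{R}^m$, $u_0=x_0$, $\tau_0>0$, $\beta>0$, $\psi\in(1,\varphi)$, $\rho\in[1,\frac1\psi+\frac1{\psi^2}]$, $0<r_1<r<\frac\rho2$. Let $(\xi_k)_{k\ge0}$ be a real sequence with $\rho+\xi_k>1$ for all $k$ and $\sum_{k=1}^\infty\log(\rho+\xi_k)<+\infty$. Set $\bar\lambda:=\lambda_{\min}(S)$. For $k=1,2,\dots$: $$u_k=\tfrac{\psi-1}{\psi}x_{k-1}+\tfrac1\psi u_{k-1},\qquad x_k=\arg\min_x\Big\{\mathbb{L}(x,w_{k-1},y_{k-1})+\tfrac1{2\tau_{k-1}}\|x-u_k\|_S^2\Big\},$$ $$\tau_k=\begin{cases}\dfrac{r_1\sqrt{\bar\lambda}}{\sqrt\beta\,L_k},&\text{if }\tau_{k-1}L_k>\dfrac{r\sqrt{\bar\lambda}}{\sqrt\beta},\\[2mm](\rho+\xi_{k-1})\tau_{k-1},&\text{otherwise,}\end{cases}\qquad\sigma_k=\beta\tau_k,$$ where $L_k:=\frac{\|Ax_k-Ax_{k-1}\|}{\|x_k-x_{k-1}\|}$ if $x_k\ne x_{k-1}$ (and the "otherwise" branch is used if $x_k=x_{k-1}$), $$w_k=\arg\min_w\Big\{\mathbb{L}_{\sigma_k}(x_k,w,y_{k-1})+\tfrac1{2\sigma_k}\|w-w_{k-1}\|_T^2\Big\},\qquad y_k=y_{k-1}+\sigma_k(Ax_k+Bw_k-b).$$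 *)

theory Defs
  imports "HOL-Analysis.Analysis"
begin

text \<open>Functions into $R \cup \{+\infty\}$ are maps into \<^typ>\<open>ereal\<close>; the value $-\infty$ is
  excluded by properness. Closedness and convexity are those of the epigraph.\<close>

definition ereal_epigraph :: "('a \<Rightarrow> ereal) \<Rightarrow> ('a \<times> real) set" where
  "ereal_epigraph h = {(x, t). h x \<le> ereal t}"

definition ereal_dom :: "('a \<Rightarrow> ereal) \<Rightarrow> 'a set" where
  "ereal_dom h = {x. h x < \<infinity>}"

definition proper_closed_convex :: "('a::euclidean_space \<Rightarrow> ereal) \<Rightarrow> bool" where
  "proper_closed_convex h \<longleftrightarrow>
     (\<forall>x. h x \<noteq> -\<infinity>) \<and> (\<exists>x. h x \<noteq> \<infinity>) \<and>
     closed (ereal_epigraph h) \<and> convex (ereal_epigraph h)"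

definition lagrangian ::
  "(real^'q \<Rightarrow> ereal) \<Rightarrow> (real^'p \<Rightarrow> ereal) \<Rightarrow> real^'q^'m \<Rightarrow> real^'p^'m \<Rightarrow> real^'m
    \<Rightarrow> real^'q \<Rightarrow> real^'p \<Rightarrow> real^'m \<Rightarrow> ereal" where
  "lagrangian g f A B b x w y = g x + f w + ereal (y \<bullet> (A *v x + B *v w - b))"

definition aug_lagrangian ::
  "(real^'q \<Rightarrow> ereal) \<Rightarrow> (real^'p \<Rightarrow> ereal) \<Rightarrow> real^'q^'m \<Rightarrow> real^'p^'m \<Rightarrow> real^'m
    \<Rightarrow> real \<Rightarrow> real^'q \<Rightarrow> real^'p \<Rightarrow> real^'m \<Rightarrow> ereal" where
  "aug_lagrangian g f A B b \<sigma> x w y =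
     lagrangian g f A B b x w y + ereal (\<sigma> / 2 * (norm (A *v x + B *v w - b))\<^sup>2)"

definition solution_set ::
  "(real^'q \<Rightarrow> ereal) \<Rightarrow> (real^'p \<Rightarrow> ereal) \<Rightarrow> real^'q^'m \<Rightarrow> real^'p^'m \<Rightarrow> real^'m
    \<Rightarrow> ((real^'q) \<times> (real^'p)) set" where
  "solution_set g f A B b =
     {z. is_arg_min (\<lambda>(x, w). g x + f w) (\<lambda>(x, w). A *v x + B *v w = b) z}"

definition sym_pos_def :: "real^'n^'n \<Rightarrow> bool" where
  "sym_pos_def M \<longleftrightarrow> transpose M = M \<and> (\<forall>v. v \<noteq> 0 \<longrightarrow> v \<bullet> (M *v v) > 0)"

definition weighted_norm :: "real^'n^'n \<Rightarrow> real^'n \<Rightarrow> real" where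
  "weighted_norm M v = sqrt (v \<bullet> (M *v v))"

definition real_eigenvalues :: "real^'n^'n \<Rightarrow> real set" where
  "real_eigenvalues M = {c. \<exists>v. v \<noteq> 0 \<and> M *v v = c *\<^sub>R v}"

text \<open>For symmetric \<open>M\<close> the set of eigenvalues is finite and nonempty, so the minimum is
  meaningful.\<close>

definition lambda_min :: "real^'n^'n \<Rightarrow> real" where
  "lambda_min M = Min (real_eigenvalues M)"

definition mat_opnorm :: "real^'n^'m \<Rightarrow> real" where
  "mat_opnorm A = onorm ((*v) A)"

text \<open>The objective of the \<open>x\<close>-subproblem is the Lagrangian plus the proximal term with the
  additive constant \<open>f w\<close> left out (the Lagrangian is taken with \<open>\<lambda>_. 0\<close> in place of \<open>f\<close>).
  If \<open>w\<close> lies in the domain of \<open>f\<close> this does not affect the minimisers, see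
  \<open>is_arg_min_x_objective_iff\<close> below. Only the starting point \<open>w\<^sub>0\<close> may lie outside; then the
  objective including \<open>f w\<close> would be identically infinite and the minimisation void.\<close>

definition x_objective ::
  "(real^'q \<Rightarrow> ereal) \<Rightarrow> real^'q^'m \<Rightarrow> real^'p^'m \<Rightarrow> real^'m \<Rightarrow> real^'q^'q
    \<Rightarrow> real \<Rightarrow> real^'q \<Rightarrow> real^'p \<Rightarrow> real^'m \<Rightarrow> real^'q \<Rightarrow> ereal" where
  "x_objective g A B b S \<tau> u w y x =
     lagrangian g (\<lambda>_. 0) A B b x w y + ereal (1 / (2 * \<tau>) * (weighted_norm S (x - u))\<^sup>2)"

definition w_objective ::
  "(real^'q \<Rightarrow> ereal) \<Rightarrow> (real^'p \<Rightarrow> ereal) \<Rightarrow> real^'q^'m \<Rightarrow> real^'p^'m \<Rightarrow> real^'m \<Rightarrow> real^'p^'p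
    \<Rightarrow> real \<Rightarrow> real^'p \<Rightarrow> real^'q \<Rightarrow> real^'m \<Rightarrow> real^'p \<Rightarrow> ereal" where
  "w_objective g f A B b T \<sigma> w' x y w =
     aug_lagrangian g f A B b \<sigma> x w y + ereal (1 / (2 * \<sigma>) * (weighted_norm T (w - w'))\<^sup>2)"

lemma is_arg_min_x_objective_iff:
  fixes g :: "real^'q \<Rightarrow> ereal" and f :: "real^'p \<Rightarrow> ereal"
    and A :: "real^'q^'m" and B :: "real^'p^'m"
  assumes "f w \<noteq> -\<infinity>" and "f w \<noteq> \<infinity>"
  shows "is_arg_min (x_objective g A B b S \<tau> u w y) (\<lambda>_. True) z \<longleftrightarrow>
    is_arg_min (\<lambda>x. lagrangian g f A B b x w y
        + ereal (1 / (2 * \<tau>) * (weighted_norm S (x - u))\<^sup>2)) (\<lambda>_. True) z"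
proof -
  obtain c where c: "f w = ereal c"
    using assms by (cases "f w") auto
  have "lagrangian g f A B b x w y + ereal (1 / (2 * \<tau>) * (weighted_norm S (x - u))\<^sup>2)
      = x_objective g A B b S \<tau> u w y x + ereal c" for x
    by (cases "g x") (simp_all add: x_objective_def lagrangian_def c)
  moreover have "a + ereal c < a' + ereal c \<longleftrightarrow> a < a'" for a a' :: ereal
    by (cases a; cases a') auto
  ultimately show ?thesis
    by (simp add: is_arg_min_def)
qed

definition lip_ratio :: "real^'q^'m \<Rightarrow> real^'q \<Rightarrow> real^'q \<Rightarrow> real" where
  "lip_ratio A x' x = norm (A *v x - A *v x') / norm (x - x')"

text \<open>One pass of the loop, \<open>k\<close> being the iteration number minus one: the iterates with index
  \<open>Suc k\<close> are produced from those with index \<open>k\<close>.\<close>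

definition algorithm_step ::
  "(real^'q \<Rightarrow> ereal) \<Rightarrow> (real^'p \<Rightarrow> ereal) \<Rightarrow> real^'q^'m \<Rightarrow> real^'p^'m \<Rightarrow> real^'m
    \<Rightarrow> real^'q^'q \<Rightarrow> real^'p^'p \<Rightarrow> real \<Rightarrow> real \<Rightarrow> real \<Rightarrow> real \<Rightarrow> real \<Rightarrow> (nat \<Rightarrow> real)
    \<Rightarrow> (nat \<Rightarrow> real^'q) \<Rightarrow> (nat \<Rightarrow> real^'q) \<Rightarrow> (nat \<Rightarrow> real^'p) \<Rightarrow> (nat \<Rightarrow> real^'m)
    \<Rightarrow> (nat \<Rightarrow> real) \<Rightarrow> (nat \<Rightarrow> real) \<Rightarrow> nat \<Rightarrow> bool" where
  "algorithm_step g f A B b S T \<beta> \<psi> \<rho> r\<^sub>1 r \<xi> u x w y \<tau> \<sigma> k \<longleftrightarrow>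
     u (Suc k) = ((\<psi> - 1) / \<psi>) *\<^sub>R x k + (1 / \<psi>) *\<^sub>R u k \<and>
     is_arg_min (x_objective g A B b S (\<tau> k) (u (Suc k)) (w k) (y k)) (\<lambda>_. True) (x (Suc k)) \<and>
     \<tau> (Suc k) =
       (if x (Suc k) \<noteq> x k \<and>
           \<tau> k * lip_ratio A (x k) (x (Suc k)) > r * sqrt (lambda_min S) / sqrt \<beta>
        then r\<^sub>1 * sqrt (lambda_min S) / (sqrt \<beta> * lip_ratio A (x k) (x (Suc k)))
        else (\<rho> + \<xi> k) * \<tau> k) \<and>
     \<sigma> (Suc k) = \<beta> * \<tau> (Suc k) \<and>
     is_arg_min (w_objective g f A B b T (\<sigma> (Suc k)) (w k) (x (Suc k)) (y k)) (\<lambda>_. True)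
       (w (Suc k)) \<and>
     y (Suc k) = y k + \<sigma> (Suc k) *\<^sub>R (A *v x (Suc k) + B *v w (Suc k) - b)"

definition tau_min :: "real^'q^'m \<Rightarrow> real^'q^'q \<Rightarrow> real \<Rightarrow> real \<Rightarrow> real \<Rightarrow> real" where
  "tau_min A S \<beta> r\<^sub>1 \<tau>\<^sub>0 =
     (if A = 0 then \<tau>\<^sub>0
      else min \<tau>\<^sub>0 (sqrt (lambda_min S) * r\<^sub>1 / (sqrt \<beta> * mat_opnorm A)))"

end

theory Submission
  imports Defs
begin

text \<open>Every step satisfies \<open>\<tau>\<^sub>k\<^sub>+\<^sub>1 \<le> (\<rho> + \<xi>\<^sub>k) \<tau>\<^sub>k\<close>: in the reducing branch even
  \<open>\<tau>\<^sub>k\<^sub>+\<^sub>1 < \<tau>\<^sub>k\<close>, because \<open>r\<^sub>1 < r\<close>. So \<open>ln \<tau>\<^sub>k\<close> minus the partial sum of the \<open>ln (\<rho> + \<xi>\<^sub>i)\<close> is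
  decreasing. It is bounded below because the series converges and \<open>L\<^sub>k \<le> \<parallel>A\<parallel>\<close> keeps \<open>\<tau>\<^sub>k\<close> above
  \<open>\<tau>\<^sub>m\<^sub>i\<^sub>n\<close>. Hence \<open>ln \<tau>\<^sub>k\<close> converges.\<close>

lemma symmetric_matrix_inner_swap:
  fixes M :: "real^'n^'n"
  assumes "transpose M = M"
  shows "v \<bullet> (M *v w) = (M *v v) \<bullet> w"
  by (metis assms dot_lmul_matrix transpose_matrix_vector)

text \<open>Eigenvectors for distinct eigenvalues of a symmetric matrix are orthogonal, so one
  chosen per eigenvalue gives an independent, hence finite, family. With nonemptiness this makes the
  \<open>Min\<close> in \<open>lambda_min\<close> an actual eigenvalue.\<close>

lemma finite_real_eigenvalues:
  fixes M :: "real^'n^'n"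
  assumes sym: "transpose M = M"
  shows "finite (real_eigenvalues M)"
proof -
  have "\<exists>e. \<forall>c\<in>real_eigenvalues M. e c \<noteq> 0 \<and> M *v e c = c *\<^sub>R e c"
    by (rule bchoice) (auto simp: real_eigenvalues_def)
  then obtain e where e: "e c \<noteq> 0" "M *v e c = c *\<^sub>R e c" if "c \<in> real_eigenvalues M" for c
    by blast
  have orth: "e c \<bullet> e d = 0"
    if "c \<in> real_eigenvalues M" "d \<in> real_eigenvalues M" "c \<noteq> d" for c d
  proof -
    have "d * (e c \<bullet> e d) = c * (e c \<bullet> e d)"
      using symmetric_matrix_inner_swap[OF sym, of "e c" "e d"] e(2) that by simp
    with that(3) show ?thesis by simp
  qed
  \<comment> \<open>A vector shared by two distinct eigenvalues would be orthogonal to itself, hence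
    zero.\<close>
  have "inj_on e (real_eigenvalues M)"
    by (rule inj_onI) (metis e(1) inner_eq_zero_iff orth)
  moreover have "finite (e ` real_eigenvalues M)"
  proof (rule independent_imp_finite, rule pairwise_orthogonal_independent)
    show "pairwise orthogonal (e ` real_eigenvalues M)"
      unfolding pairwise_def orthogonal_def using orth by blast
    show "0 \<notin> e ` real_eigenvalues M"
      using e(1) by force
  qed
  ultimately show ?thesis
    by (rule finite_imageD[rotated])
qed

text \<open>If \<open>N *v v\<close> were nonzero, a small step from \<open>v\<close> in the
  direction opposite to \<open>N *v v\<close> would make the quadratic form negative.\<close>

lemma psd_matrix_kernel:
  fixes N :: "real^'n^'n"
  assumes sym: "transpose N = N" and psd: "\<And>v. 0 \<le> v \<bullet> (N *v v)" and "v \<bullet> (N *v v) = 0"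
  shows "N *v v = 0"
proof -
  define h where "h = N *v v"
  define a c where "a = h \<bullet> h" and "c = h \<bullet> (N *v h)"
  \<comment> \<open>The form along the line is 2 t a + t^2 c, with minimiser - a / c when c > 0. The
    denominator c + 1 also covers c = 0 and still gives a negative value unless a = 0.\<close>
  define t where "t = - a / (c + 1)"
  have "c \<ge> 0"
    using psd by (simp add: c_def)
  have "v \<bullet> (N *v h) = a"
    using symmetric_matrix_inner_swap[OF sym, of v h] by (simp add: a_def h_def)
  then have "(v + t *\<^sub>R h) \<bullet> (N *v (v + t *\<^sub>R h)) = 2 * t * a + t\<^sup>2 * c"
    using assms(3)
    by (simp add: matrix_vector_right_distrib matrix_vector_mult_scaleR inner_add_left
        inner_add_right a_def c_def power2_eq_square algebra_simps flip: h_def)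
  also have "\<dots> = - (a\<^sup>2 * (c + 2) / (c + 1)\<^sup>2)"
    using \<open>c \<ge> 0\<close> by (simp add: t_def divide_simps power2_eq_square) algebra
  finally have "a\<^sup>2 * (c + 2) / (c + 1)\<^sup>2 \<le> 0"
    using psd[of "v + t *\<^sub>R h"] by linarith
  then have "a = 0"
    using \<open>c \<ge> 0\<close> by (auto simp: divide_le_0_iff mult_le_0_iff)
  then show ?thesis
    by (simp add: a_def h_def)
qed

text \<open>A minimiser of the Rayleigh quotient on the unit sphere is an eigenvector.\<close>

lemma real_eigenvalues_nonempty:
  fixes M :: "real^'n^'n"
  assumes sym: "transpose M = M"
  shows "real_eigenvalues M \<noteq> {}"
proof -
  obtain v :: "real^'n" where v: "norm v = 1"
    and min: "\<And>z. norm z = 1 \<Longrightarrow> v \<bullet> (M *v v) \<le> z \<bullet> (M *v z)"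
  proof -
    have "\<exists>v\<in>sphere (0::real^'n) 1. \<forall>z\<in>sphere 0 1. v \<bullet> (M *v v) \<le> z \<bullet> (M *v z)"
    proof (rule continuous_attains_inf)
      show "continuous_on (sphere 0 1) (\<lambda>v. v \<bullet> (M *v v))"
        by (intro continuous_intros linear_continuous_on matrix_vector_mul_bounded_linear)
    qed auto
    then show thesis
      using that by auto
  qed
  define \<mu> where "\<mu> = v \<bullet> (M *v v)"
  \<comment> \<open>Minimality of \<mu> makes the shifted matrix positive semidefinite, and its form
    vanishes at \<open>v\<close>; so \<open>v\<close> lies in its kernel.\<close>
  define N where "N = M - \<mu> *\<^sub>R mat 1"
  have N: "N *v z = M *v z - \<mu> *\<^sub>R z" for z
    by (simp add: N_def matrix_vector_mult_diff_rdistrib scaleR_matrix_vector_assoc[symmetric])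
  have "N *v v = 0"
  proof (rule psd_matrix_kernel)
    show "transpose N = N"
      using sym by (simp add: N_def transpose_def vec_eq_iff mat_def)
    show "0 \<le> z \<bullet> (N *v z)" for z
    proof (cases "z = 0")
      case False
      have "\<mu> \<le> (z /\<^sub>R norm z) \<bullet> (M *v (z /\<^sub>R norm z))"
        unfolding \<mu>_def using False by (intro min) simp
      then have "\<mu> * (norm z)\<^sup>2 \<le> z \<bullet> (M *v z)"
        using False by (simp add: matrix_vector_mult_scaleR field_simps power2_eq_square)
      then show ?thesis
        by (simp add: N inner_diff_right power2_norm_eq_inner)
    qed simp
    show "v \<bullet> (N *v v) = 0"
      using v by (simp add: N inner_diff_right \<mu>_def norm_eq_1)
  qed
  then have "M *v v = \<mu> *\<^sub>R v"
    by (simp add: N)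
  moreover have "v \<noteq> 0"
    using v by auto
  ultimately show ?thesis
    unfolding real_eigenvalues_def by blast
qed

lemma lambda_min_pos:
  assumes "sym_pos_def M"
  shows "lambda_min M > 0"
proof -
  have sym: "transpose M = M"
    using assms by (simp add: sym_pos_def_def)
  have "c > 0" if "c \<in> real_eigenvalues M" for c
  proof -
    obtain v where v: "v \<noteq> 0" "M *v v = c *\<^sub>R v"
      using \<open>c \<in> real_eigenvalues M\<close> by (auto simp: real_eigenvalues_def)
    then have "c * (v \<bullet> v) > 0"
      using assms unfolding sym_pos_def_def by (metis inner_scaleR_right)
    then show ?thesis
      using inner_ge_zero[of v] by (simp add: zero_less_mult_iff)
  qed
  then show ?thesis
    unfolding lambda_min_def
    using finite_real_eigenvalues[OF sym] real_eigenvalues_nonempty[OF sym] by simp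
qed

lemma lip_ratio_le_mat_opnorm: "lip_ratio A v z \<le> mat_opnorm A"
proof -
  have bl: "bounded_linear ((*v) A)"
    by (rule matrix_vector_mul_bounded_linear)
  have "norm (A *v (z - v)) \<le> mat_opnorm A * norm (z - v)"
    unfolding mat_opnorm_def by (rule onorm[OF bl])
  then show ?thesis
    using onorm_pos_le[OF bl]
    \<comment> \<open>For \<open>z = v\<close> the ratio is 0 / 0 = 0, so nonnegativity of the
      operator norm suffices.\<close>
    by (cases "z = v")
      (auto simp: lip_ratio_def mat_opnorm_def matrix_vector_mult_diff_distrib field_simps)
qed

text \<open>Needed in both directions: for \<open>A \<noteq> 0\<close> it makes the quotient in
  \<open>tau_min\<close> positive, and a positive difference quotient rules out
  \<open>A = 0\<close>.\<close>

lemma mat_opnorm_pos_iff: "0 < mat_opnorm A \<longleftrightarrow> A \<noteq> 0"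
proof -
  have "(\<forall>v. A *v v = 0) \<longleftrightarrow> A = 0"
    by (metis matrix_eq matrix_vector_mult_0)
  then show ?thesis
    unfolding mat_opnorm_def by (simp add: onorm_pos_lt matrix_vector_mul_bounded_linear)
qed

text \<open>The factors may exceed one, so the sequence itself need not be monotone; dividing out
  the accumulated growth makes it so.\<close>

lemma convergent_if_multiplicative_growth_summable:
  fixes \<tau> \<alpha> :: "nat \<Rightarrow> real"
  assumes "0 < m" and lower: "\<And>k. m \<le> \<tau> k" and growth: "\<And>k. \<tau> (Suc k) \<le> \<alpha> k * \<tau> k"
    and "\<And>k. 0 < \<alpha> k" and summable: "summable (\<lambda>k. ln (\<alpha> k))"
  shows "\<exists>l\<ge>m. \<tau> \<longlonglongrightarrow> l"
proof -
  have pos: "\<tau> k > 0" for k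
    using lower[of k] \<open>0 < m\<close> by linarith
  define s where "s k = (\<Sum>i<k. ln (\<alpha> i))" for k
  have conv: "convergent s"
    using summable unfolding s_def summable_iff_convergent .
  then obtain C where C: "\<And>k. \<bar>s k\<bar> \<le> C"
    using convergent_imp_Bseq[THEN BseqD] by (metis real_norm_def)
  define d where "d k = ln (\<tau> k) - s k" for k
  have "ln (\<tau> (Suc k)) \<le> ln (\<alpha> k) + ln (\<tau> k)" for k
    using growth[of k] pos assms(4) by (metis ln_mono ln_mult_pos)
  then have "decseq d"
    by (auto intro!: decseq_SucI simp: d_def s_def algebra_simps)
  moreover have "ln m - C \<le> d k" for k
  proof -
    have "ln m \<le> ln (\<tau> k)"
      using lower[of k] \<open>0 < m\<close> by (rule ln_mono)
    then show ?thesis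
      using C[of k] by (simp add: d_def)
  qed
  ultimately obtain l where "d \<longlonglongrightarrow> l"
    using decseq_convergent by metis
  moreover obtain l' where "s \<longlonglongrightarrow> l'"
    using conv by (auto simp: convergent_def)
  \<comment> \<open>Adding the partial sums back recovers \<open>ln (\<tau> k)\<close>;
    exponentiating returns to the original sequence.\<close>
  ultimately have "(\<lambda>k. exp (d k + s k)) \<longlonglongrightarrow> exp (l + l')"
    by (intro tendsto_intros)
  then have "\<tau> \<longlonglongrightarrow> exp (l + l')"
    using pos by (simp add: d_def)
  moreover from this have "m \<le> exp (l + l')"
    using lower by (intro LIMSEQ_le_const) auto
  ultimately show ?thesis
    by blast
qed

theorem mainTheorem7:
  fixes g :: "real^'q \<Rightarrow> ereal" and f :: "real^'p \<Rightarrow> ereal"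
    and A :: "real^'q^'m" and B :: "real^'p^'m" and b :: "real^'m"
    and S :: "real^'q^'q" and T :: "real^'p^'p"
    and \<beta> \<psi> \<rho> r\<^sub>1 r :: real and \<xi> \<tau> \<sigma> :: "nat \<Rightarrow> real"
    and x u :: "nat \<Rightarrow> real^'q" and w :: "nat \<Rightarrow> real^'p" and y :: "nat \<Rightarrow> real^'m"
  assumes "proper_closed_convex g" and "proper_closed_convex f"
    and "solution_set g f A B b \<noteq> {}"
    and "\<exists>x' \<in> rel_interior (ereal_dom g). \<exists>w' \<in> rel_interior (ereal_dom f).
           A *v x' + B *v w' = b"
    and "sym_pos_def S" and "sym_pos_def T"
    and "u 0 = x 0" and "\<tau> 0 > 0" and "\<beta> > 0"
    and "1 < \<psi>" and "\<psi> < (1 + sqrt 5) / 2"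
    and "1 \<le> \<rho>" and "\<rho> \<le> 1 / \<psi> + 1 / \<psi>\<^sup>2"
    and "0 < r\<^sub>1" and "r\<^sub>1 < r" and "r < \<rho> / 2"
    and "\<And>k. \<rho> + \<xi> k > 1"
    and "summable (\<lambda>k. ln (\<rho> + \<xi> (Suc k)))"
    and "\<And>k. algorithm_step g f A B b S T \<beta> \<psi> \<rho> r\<^sub>1 r \<xi> u x w y \<tau> \<sigma> k"
  shows "tau_min A S \<beta> r\<^sub>1 (\<tau> 0) > 0 \<and>
    (\<exists>\<tau>\<^sub>s. \<tau>\<^sub>s \<ge> tau_min A S \<beta> r\<^sub>1 (\<tau> 0) \<and> \<tau> \<longlonglongrightarrow> \<tau>\<^sub>s)"
proof -
  define c where "c = sqrt (lambda_min S) / sqrt \<beta>"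
  define L where "L k = lip_ratio A (x k) (x (Suc k))" for k
  define m where "m = tau_min A S \<beta> r\<^sub>1 (\<tau> 0)"
  have "c > 0"
    using lambda_min_pos[OF \<open>sym_pos_def S\<close>] \<open>\<beta> > 0\<close> by (simp add: c_def)
  have m: "m = (if A = 0 then \<tau> 0 else min (\<tau> 0) (r\<^sub>1 * c / mat_opnorm A))"
    by (simp add: m_def tau_min_def c_def mult_ac)
  have "m > 0"
    using mat_opnorm_pos_iff[of A] \<open>c > 0\<close> \<open>0 < r\<^sub>1\<close> \<open>\<tau> 0 > 0\<close> by (simp add: m)
  have step: "\<tau> (Suc k) = (if x (Suc k) \<noteq> x k \<and> \<tau> k * L k > r * c
      then r\<^sub>1 * c / L k else (\<rho> + \<xi> k) * \<tau> k)" for k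
    using assms(19)[of k] by (simp add: algorithm_step_def c_def L_def)
  \<comment> \<open>The lower bound is both hypothesis and conclusion, so that it propagates by
    induction; the growth bound needs it for \<open>\<tau> k > 0\<close>.\<close>
  have step_bounds: "m \<le> \<tau> (Suc k) \<and> \<tau> (Suc k) \<le> (\<rho> + \<xi> k) * \<tau> k" if "m \<le> \<tau> k" for k
  proof -
    have "\<tau> k > 0"
      using \<open>m \<le> \<tau> k\<close> \<open>m > 0\<close> by linarith
    then have grow: "\<tau> k \<le> (\<rho> + \<xi> k) * \<tau> k"
      using \<open>\<And>k. \<rho> + \<xi> k > 1\<close>[of k] by simp
    show ?thesis
    proof (cases "x (Suc k) \<noteq> x k \<and> \<tau> k * L k > r * c")
      case True
      have "r * c > 0"
        using \<open>0 < r\<^sub>1\<close> \<open>r\<^sub>1 < r\<close> \<open>c > 0\<close> by simp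
      then have "\<tau> k * L k > 0"
        using True by linarith
      then have "L k > 0"
        using \<open>\<tau> k > 0\<close> by (simp add: zero_less_mult_iff)
      have "L k \<le> mat_opnorm A"
        by (simp add: L_def lip_ratio_le_mat_opnorm)
      then have "A \<noteq> 0"
        using \<open>L k > 0\<close> mat_opnorm_pos_iff[of A] by linarith
      then have "m \<le> r\<^sub>1 * c / mat_opnorm A"
        by (simp add: m)
      also have "\<dots> \<le> r\<^sub>1 * c / L k"
        using \<open>L k > 0\<close> \<open>L k \<le> mat_opnorm A\<close> \<open>0 < r\<^sub>1\<close> \<open>c > 0\<close>
        by (intro divide_left_mono) auto
      finally have "m \<le> r\<^sub>1 * c / L k" .
      \<comment> \<open>The branch condition gives \<open>r * c < \<tau> k * L k\<close>, and
        \<open>r\<^sub>1 < r\<close>; hence the new step size does not exceed the old one.\<close>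
      moreover have "r\<^sub>1 * c < \<tau> k * L k"
        using True \<open>r\<^sub>1 < r\<close> \<open>c > 0\<close> by (meson mult_strict_right_mono order_less_trans)
      then have "r\<^sub>1 * c / L k \<le> \<tau> k"
        using \<open>L k > 0\<close> by (simp add: field_simps)
      ultimately show ?thesis
        using True grow step[of k] by simp
    next
      case False
      then have "\<tau> (Suc k) = (\<rho> + \<xi> k) * \<tau> k"
        by (simp only: step[of k] if_False)
      then show ?thesis
        using grow \<open>m \<le> \<tau> k\<close> by simp
    qed
  qed
  have lower: "m \<le> \<tau> k" for k
  proof (induction k)
    case 0
    show ?case by (simp add: m)
  next
    case (Suc k)
    then show ?case by (simp add: step_bounds)
  qed
  have "\<exists>l\<ge>m. \<tau> \<longlonglongrightarrow> l"
  proof (rule convergent_if_multiplicative_growth_summable)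
    \<comment> \<open>The given series starts at index 1, while the first update already uses
      \<open>\<xi> 0\<close>; one extra term leaves summability intact.\<close>
    show "summable (\<lambda>k. ln (\<rho> + \<xi> k))"
      using \<open>summable (\<lambda>k. ln (\<rho> + \<xi> (Suc k)))\<close>
        summable_Suc_iff[of "\<lambda>k. ln (\<rho> + \<xi> k)"] by simp
    show "0 < \<rho> + \<xi> k" for k
      using \<open>\<And>k. \<rho> + \<xi> k > 1\<close>[of k] by linarith
  qed (use \<open>m > 0\<close> lower step_bounds in auto)
  then show ?thesis
    using \<open>m > 0\<close> unfolding m_def by blast
qed

end
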